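(* Let $W_J$ be a standard parabolic subgroup of a Coxeter group $W$. (i) If $W$ is futuristic, then $W_J$ is futuristic. (ii) If $W_J$ is ancient, then $W$ is ancient.
   Context: Let $(W,S)$ be a Coxeter system with $S=\{s_i:i\in I\}$, $I$ a finite index set; $m(i,i')$ is the order of $s_is_{i'}$. For $J\subseteq I$, the standard parabolic subgroup $W_J$ is the subgroup generated by $\{s_i:i\in J\}$, regarded as a Coxeter group with Coxeter system $(W_J,\{s_i:i\in J\})$. The root space is $V=\mathbb R^I$ with standard basis the simple roots $\{\alpha_i:i\in I\}$ and symmetric bilinear form $B(\alpha_i,\alpha_{i'})=-\cos(\pi/m(i,i'))$ (and $-1$ if $m(i,i')=\infty$). $W$ acts on $V$ by $s_i\beta=\beta-2B(\beta,\alpha_i)\alpha_i$. The root system is $\Phi=\{w\alpha_i:w\in W,i\in I\}=\Phi^+\sqcup\Phi^-$, where $\Phi^+$ are the roots that are nonnegative combinations of simple roots and $\Phi^-=-\Phi^+$. For $\beta\in\Phi$ the half-space $H_\beta^+$ is $\{w\in W:w\beta\in\Phi^+\}$. A subset of $W$ is convex if it is an intersection of half-spaces (the empty intersection being $W$). For a nonempty convex set $\mathscr L\subseteq W$ let $\mathrm R(\mathscr L)=\{\beta\in\Phi:\mathscr L\subseteq H_\beta^+\}$. For $i\in I$, the toggle $\tau_i\colon W\to W$ is defined by $\tau_i(u)=u$ if $u^{-1}\alpha_i\in\mathrm R(\mathscr L)$ and $\tau_i(u)=s_iu$ otherwise. A Coxeter element is a product $c=s_{i_n}\cdots s_{i_1}$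 where $i_1,\ldots,i_n$ is an ordering of $I$ (each element once); $\mathrm{Pro}_c=\tau_{i_n}\cdots\tau_{i_1}$ (composition), which depends only on $c$ and $\mathscr L$. The set $\mathscr L$ is heavy with respect to $c$ if every periodic point of $\mathrm{Pro}_c$ (i.e. every $u\in W$ with $\mathrm{Pro}_c^K(u)=u$ for some $K\ge 1$) lies in $\mathscr L$. A Coxeter element $c$ is futuristic if every nonempty convex $\mathscr L\subseteq W$ is heavy with respect to $c$. The Coxeter group $W$ is futuristic if all its Coxeter elements are futuristic, and ancient if none of them is. *)

theory Defs
  imports Complex_Main "HOL-Algebra.Elementary_Groups" "HOL-Algebra.Multiplicative_Group"
begin

text \<open>
  A Coxeter system is given by a group \<open>W\<close>, an index set \<open>I\<close> and a family
  \<open>s\<close> of generators indexed by \<open>I\<close>; only the values of \<open>s\<close> on \<open>I\<close> matter.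
  Words are lists over \<open>I\<close>, read from left to right.
\<close>

section \<open>Coxeter systems\<close>

definition word_prod :: "('a, 'm) monoid_scheme \<Rightarrow> ('i \<Rightarrow> 'a) \<Rightarrow> 'i list \<Rightarrow> 'a" where
  "word_prod W s xs = foldr (\<otimes>\<^bsub>W\<^esub>) (map s xs) \<one>\<^bsub>W\<^esub>"

text \<open>The order of \<open>s i \<otimes> s j\<close>; as for \<^const>\<open>group.ord\<close>, infinite order is encoded by \<open>0\<close>.\<close>

definition cox_m :: "('a, 'm) monoid_scheme \<Rightarrow> ('i \<Rightarrow> 'a) \<Rightarrow> 'i \<Rightarrow> 'i \<Rightarrow> nat" where
  "cox_m W s i j = group.ord W (s i \<otimes>\<^bsub>W\<^esub> s j)"

text \<open>
  One application of a defining relation \<open>(s i s j)^m(i,j) = 1\<close> inside a word. For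
  infinite order the deleted word is empty, so no relation is imposed; for \<open>i = j\<close> it
  is \<open>[i, i]\<close>.
\<close>

inductive cox_step ::
  "('a, 'm) monoid_scheme \<Rightarrow> 'i set \<Rightarrow> ('i \<Rightarrow> 'a) \<Rightarrow> 'i list \<Rightarrow> 'i list \<Rightarrow> bool"
  for W I s where
  "\<lbrakk>us \<in> lists I; vs \<in> lists I; i \<in> I; j \<in> I\<rbrakk> \<Longrightarrow>
    cox_step W I s (us @ concat (replicate (cox_m W s i j) [i, j]) @ vs) (us @ vs)"

text \<open>
  The last assumption says that \<open>W\<close> is presented by the generators \<open>s i\<close> and the relations
  \<open>(s i s j)^m(i,j) = 1\<close>: any two words with the same value are related by these relations.
  As the relations include \<open>(s i)^2 = 1\<close>, formal inverses of generators are not needed.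
\<close>

locale coxeter_system = group W
  for W :: "('a, 'm) monoid_scheme" (structure) +
  fixes I :: "'i set" and s :: "'i \<Rightarrow> 'a"
  assumes finite_I: "finite I"
    and s_closed: "i \<in> I \<Longrightarrow> s i \<in> carrier W"
    and s_inj: "inj_on s I"
    and s_order: "i \<in> I \<Longrightarrow> ord (s i) = 2"
    and s_generate: "generate W (s ` I) = carrier W"
    and presentation:
      "\<lbrakk>xs \<in> lists I; ys \<in> lists I; word_prod W s xs = word_prod W s ys\<rbrakk>
        \<Longrightarrow> equivclp (cox_step W I s) xs ys"


section \<open>The geometric representation and roots\<close>

text \<open>Vectors of \<open>\<real>\<^sup>I\<close> are functions \<open>'i \<Rightarrow> real\<close> vanishing outside \<open>I\<close>.\<close>

definition simple_root :: "'i \<Rightarrow> 'i \<Rightarrow> real" where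
  "simple_root i = (\<lambda>j. if j = i then 1 else 0)"

definition cox_form ::
  "('a, 'm) monoid_scheme \<Rightarrow> 'i set \<Rightarrow> ('i \<Rightarrow> 'a) \<Rightarrow> ('i \<Rightarrow> real) \<Rightarrow> ('i \<Rightarrow> real) \<Rightarrow> real" where
  "cox_form W I s x y =
    (\<Sum>i\<in>I. \<Sum>j\<in>I. x i * y j *
      (if cox_m W s i j = 0 then - 1 else - cos (pi / real (cox_m W s i j))))"

definition simple_refl ::
  "('a, 'm) monoid_scheme \<Rightarrow> 'i set \<Rightarrow> ('i \<Rightarrow> 'a) \<Rightarrow> 'i \<Rightarrow> ('i \<Rightarrow> real) \<Rightarrow> ('i \<Rightarrow> real)" where
  "simple_refl W I s i v =
    (\<lambda>j. v j - 2 * cox_form W I s v (simple_root i) * simple_root i j)"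

text \<open>
  The action of \<open>w\<close> on \<open>\<real>\<^sup>I\<close>, computed from an arbitrary word for \<open>w\<close>. In a Coxeter system
  the result does not depend on the word, since the simple reflections satisfy the defining
  relations.
\<close>

definition cox_act ::
  "('a, 'm) monoid_scheme \<Rightarrow> 'i set \<Rightarrow> ('i \<Rightarrow> 'a) \<Rightarrow> 'a \<Rightarrow> ('i \<Rightarrow> real) \<Rightarrow> ('i \<Rightarrow> real)" where
  "cox_act W I s w v =
    foldr (simple_refl W I s) (SOME xs. xs \<in> lists I \<and> word_prod W s xs = w) v"

definition roots :: "('a, 'm) monoid_scheme \<Rightarrow> 'i set \<Rightarrow> ('i \<Rightarrow> 'a) \<Rightarrow> ('i \<Rightarrow> real) set" where
  "roots W I s = {cox_act W I s w (simple_root i) | w i. w \<in> carrier W \<and> i \<in> I}"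

definition pos_roots :: "('a, 'm) monoid_scheme \<Rightarrow> 'i set \<Rightarrow> ('i \<Rightarrow> 'a) \<Rightarrow> ('i \<Rightarrow> real) set" where
  "pos_roots W I s = {\<beta> \<in> roots W I s. \<forall>i\<in>I. 0 \<le> \<beta> i}"


section \<open>Convex sets\<close>

definition half_space ::
  "('a, 'm) monoid_scheme \<Rightarrow> 'i set \<Rightarrow> ('i \<Rightarrow> 'a) \<Rightarrow> ('i \<Rightarrow> real) \<Rightarrow> 'a set" where
  "half_space W I s \<beta> = {w \<in> carrier W. cox_act W I s w \<beta> \<in> pos_roots W I s}"

definition cox_convex ::
  "('a, 'm) monoid_scheme \<Rightarrow> 'i set \<Rightarrow> ('i \<Rightarrow> 'a) \<Rightarrow> 'a set \<Rightarrow> bool" where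
  "cox_convex W I s L \<longleftrightarrow>
    (\<exists>F \<subseteq> roots W I s. L = carrier W \<inter> (\<Inter>\<beta>\<in>F. half_space W I s \<beta>))"

definition convex_roots ::
  "('a, 'm) monoid_scheme \<Rightarrow> 'i set \<Rightarrow> ('i \<Rightarrow> 'a) \<Rightarrow> 'a set \<Rightarrow> ('i \<Rightarrow> real) set" where
  "convex_roots W I s L = {\<beta> \<in> roots W I s. L \<subseteq> half_space W I s \<beta>}"


section \<open>Toggles, Coxeter elements and promotion\<close>

definition toggle ::
  "('a, 'm) monoid_scheme \<Rightarrow> 'i set \<Rightarrow> ('i \<Rightarrow> 'a) \<Rightarrow> 'a set \<Rightarrow> 'i \<Rightarrow> 'a \<Rightarrow> 'a" where
  "toggle W I s L i u =
    (if cox_act W I s (inv\<^bsub>W\<^esub> u) (simple_root i) \<in> convex_roots W I s L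
     then u else s i \<otimes>\<^bsub>W\<^esub> u)"

text \<open>
  The list \<open>[i\<^sub>n, \<dots>, i\<^sub>1]\<close> stands for the ordering \<open>i\<^sub>1, \<dots>, i\<^sub>n\<close> of \<open>I\<close>, so that both the
  Coxeter element and the composition of toggles are written in the order of the list.
\<close>

definition cox_expressions ::
  "('a, 'm) monoid_scheme \<Rightarrow> 'i set \<Rightarrow> ('i \<Rightarrow> 'a) \<Rightarrow> 'a \<Rightarrow> 'i list set" where
  "cox_expressions W I s c = {xs. distinct xs \<and> set xs = I \<and> word_prod W s xs = c}"

definition coxeter_elements :: "('a, 'm) monoid_scheme \<Rightarrow> 'i set \<Rightarrow> ('i \<Rightarrow> 'a) \<Rightarrow> 'a set" where
  "coxeter_elements W I s = {c. cox_expressions W I s c \<noteq> {}}"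

text \<open>
  \<open>Pro\<^sub>c\<close> is computed from an arbitrary expression of \<open>c\<close>; two expressions of the same
  Coxeter element differ by exchanges of adjacent commuting generators, whose toggles commute.
\<close>

definition promotion ::
  "('a, 'm) monoid_scheme \<Rightarrow> 'i set \<Rightarrow> ('i \<Rightarrow> 'a) \<Rightarrow> 'a set \<Rightarrow> 'a \<Rightarrow> 'a \<Rightarrow> 'a" where
  "promotion W I s L c u = foldr (toggle W I s L) (SOME xs. xs \<in> cox_expressions W I s c) u"

definition heavy ::
  "('a, 'm) monoid_scheme \<Rightarrow> 'i set \<Rightarrow> ('i \<Rightarrow> 'a) \<Rightarrow> 'a \<Rightarrow> 'a set \<Rightarrow> bool" where
  "heavy W I s c L \<longleftrightarrow>
    (\<forall>u\<in>carrier W. (\<exists>K\<ge>1. (promotion W I s L c ^^ K) u = u) \<longrightarrow> u \<in> L)"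

definition futuristic_element ::
  "('a, 'm) monoid_scheme \<Rightarrow> 'i set \<Rightarrow> ('i \<Rightarrow> 'a) \<Rightarrow> 'a \<Rightarrow> bool" where
  "futuristic_element W I s c \<longleftrightarrow>
    (\<forall>L. L \<noteq> {} \<and> cox_convex W I s L \<longrightarrow> heavy W I s c L)"

definition futuristic :: "('a, 'm) monoid_scheme \<Rightarrow> 'i set \<Rightarrow> ('i \<Rightarrow> 'a) \<Rightarrow> bool" where
  "futuristic W I s \<longleftrightarrow> (\<forall>c\<in>coxeter_elements W I s. futuristic_element W I s c)"

definition ancient :: "('a, 'm) monoid_scheme \<Rightarrow> 'i set \<Rightarrow> ('i \<Rightarrow> 'a) \<Rightarrow> bool" where
  "ancient W I s \<longleftrightarrow> (\<forall>c\<in>coxeter_elements W I s. \<not> futuristic_element W I s c)"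

end

(*
  Every Coxeter element c of W restricts to a Coxeter element c' of W_J, by deleting the letters
  outside J, and every Coxeter element of W_J arises in this way. So it suffices that c' is
  futuristic if c is. Given a convex subset L' of W_J, let L be the convex subset of W defined by
  the roots of R(L') and by the roots w \<alpha>\<^sub>i with w in W_J and i outside J. The latter are positive
  on W_J, so the toggles \<tau>\<^sub>i with i outside J fix W_J pointwise, and L intersects W_J in L'. On W_J,
  promotion by c with respect to L is therefore promotion by c' with respect to L', and a periodic
  point outside L' would be a periodic point outside L.
*)
theory Submission
  imports Defs
begin

lemma simple_root_same [simp]: "simple_root i i = 1"
  by (simp add: simple_root_def)

lemma simple_root_other: "k \<noteq> i \<Longrightarrow> simple_root i k = 0"
  by (simp add: simple_root_def)

context coxeter_system
begin

abbreviation wp :: "'i list \<Rightarrow> 'a" where "wp \<equiv> word_prod W s"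
abbreviation m :: "'i \<Rightarrow> 'i \<Rightarrow> nat" where "m \<equiv> cox_m W s"
abbreviation refl :: "'i \<Rightarrow> ('i \<Rightarrow> real) \<Rightarrow> 'i \<Rightarrow> real" where "refl \<equiv> simple_refl W I s"
abbreviation act :: "'a \<Rightarrow> ('i \<Rightarrow> real) \<Rightarrow> 'i \<Rightarrow> real" where "act \<equiv> cox_act W I s"

section \<open>Words and generators\<close>

lemma wp_Nil [simp]: "wp [] = \<one>"
  by (simp add: word_prod_def)

lemma wp_Cons [simp]: "wp (x # xs) = s x \<otimes> wp xs"
  by (simp add: word_prod_def)

lemma wp_closed [simp]: "xs \<in> lists I \<Longrightarrow> wp xs \<in> carrier W"
  by (induction xs) (auto simp: s_closed)

lemma wp_append: "xs \<in> lists I \<Longrightarrow> ys \<in> lists I \<Longrightarrow> wp (xs @ ys) = wp xs \<otimes> wp ys"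
  by (induction xs) (auto simp: s_closed m_assoc)

lemma s_square [simp]: "i \<in> I \<Longrightarrow> s i \<otimes> s i = \<one>"
  using pow_ord_eq_1[of "s i"] by (simp add: s_order s_closed numeral_2_eq_2)

lemma s_cancel [simp]: "i \<in> I \<Longrightarrow> w \<in> carrier W \<Longrightarrow> s i \<otimes> (s i \<otimes> w) = w"
  by (simp add: s_closed flip: m_assoc)

lemma s_cancel_right [simp]: "i \<in> I \<Longrightarrow> w \<in> carrier W \<Longrightarrow> w \<otimes> s i \<otimes> s i = w"
  by (simp add: s_closed m_assoc)

lemma inv_s [simp]: "i \<in> I \<Longrightarrow> inv (s i) = s i"
  by (simp add: s_closed inv_equality)

lemma inv_s_s: "i \<in> I \<Longrightarrow> j \<in> I \<Longrightarrow> inv (s i \<otimes> s j) = s j \<otimes> s i"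
  by (simp add: inv_mult_group s_closed)

lemma generate_eq_words:
  assumes "J \<subseteq> I"
  shows "generate W (s ` J) = wp ` lists J"
proof (intro equalityI subsetI)
  fix w assume "w \<in> generate W (s ` J)"
  then show "w \<in> wp ` lists J"
  proof (induction rule: generate.induct)
    case one
    show ?case by (rule image_eqI[of _ _ "[]"]) auto
  next
    case (incl h)
    then obtain j where "j \<in> J" "h = s j" by blast
    then show ?case using assms by (intro image_eqI[of _ _ "[j]"]) (auto simp: s_closed)
  next
    case (inv h)
    then obtain j where "j \<in> J" "h = s j" by blast
    then show ?case using assms by (intro image_eqI[of _ _ "[j]"]) (auto simp: s_closed)
  next
    case (eng h1 h2)
    then obtain xs ys where "xs \<in> lists J" "ys \<in> lists J" "h1 = wp xs" "h2 = wp ys" by blast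
    moreover have "xs \<in> lists I" "ys \<in> lists I" using calculation assms by auto
    ultimately show ?case by (intro image_eqI[of _ _ "xs @ ys"]) (simp_all add: wp_append)
  qed
next
  fix w assume "w \<in> wp ` lists J"
  then obtain xs where "xs \<in> lists J" "w = wp xs" by blast
  then show "w \<in> generate W (s ` J)"
    by (induction xs arbitrary: w) (auto intro: generate.intros)
qed

lemma carrier_eq_words: "carrier W = wp ` lists I"
  using generate_eq_words[of I] s_generate by simp

lemma m_sym: "i \<in> I \<Longrightarrow> j \<in> I \<Longrightarrow> m i j = m j i"
  unfolding cox_m_def using ord_inv[of "s i \<otimes> s j"] by (simp add: s_closed inv_s_s)

lemma m_self [simp]: "i \<in> I \<Longrightarrow> m i i = 1"
  unfolding cox_m_def by simp

text \<open>Order 1 would force s_i = s_j. Hence m is 0 or at least 2 for distinct generators, which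
  fixes the signs of the sines and cosines of pi / m below.\<close>

lemma m_neq_1:
  assumes "i \<in> I" "j \<in> I" "i \<noteq> j"
  shows "m i j \<noteq> 1"
proof
  assume "m i j = 1"
  then have "s i \<otimes> s j = \<one>" using assms by (metis cox_m_def m_closed ord_eq_1 s_closed)
  then have "s i = s j" using assms by (metis inv_equality inv_s s_closed)
  then show False using s_inj assms by (auto dest: inj_onD)
qed

lemma commute_if_m_2:
  assumes "i \<in> I" "j \<in> I" "m i j = 2"
  shows "s i \<otimes> s j = s j \<otimes> s i"
proof -
  have "(s i \<otimes> s j) [^] (2::nat) = \<one>"
    using assms by (metis cox_m_def m_closed pow_ord_eq_1 s_closed)
  then have "(s i \<otimes> s j) \<otimes> (s i \<otimes> s j) = \<one>"
    using assms by (simp add: numeral_2_eq_2 s_closed)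
  then have "inv (s i \<otimes> s j) = s i \<otimes> s j"
    using assms by (intro inv_equality) (auto simp: s_closed)
  then show ?thesis using assms by (simp add: inv_s_s)
qed

section \<open>The geometric representation\<close>

definition weight :: "'i \<Rightarrow> 'i \<Rightarrow> real" where
  "weight i j = (if m i j = 0 then - 1 else - cos (pi / real (m i j)))"

text \<open>For i in I this is B(v, alpha_i): against a simple root the double sum of
  \<open>cox_form\<close> collapses to a single one.\<close>

definition pairing :: "('i \<Rightarrow> real) \<Rightarrow> 'i \<Rightarrow> real" where
  "pairing v i = (\<Sum>k\<in>I. v k * weight k i)"

lemma weight_self [simp]: "i \<in> I \<Longrightarrow> weight i i = 1"
  by (simp add: weight_def)

lemma weight_sym: "i \<in> I \<Longrightarrow> j \<in> I \<Longrightarrow> weight i j = weight j i"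
  by (simp add: weight_def m_sym)

lemma weight_m_2: "m i j = 2 \<Longrightarrow> weight i j = 0"
  by (simp add: weight_def)

lemma weight_neg:
  assumes "i \<in> I" "j \<in> I" "i \<noteq> j" "m i j \<noteq> 2"
  shows "weight i j < 0"
proof (cases "m i j = 0")
  case False
  then have "m i j \<ge> 3" using assms m_neq_1[of i j] by linarith
  then have "pi / real (m i j) < pi / 2" by (simp add: field_simps)
  moreover have "pi / real (m i j) > 0" using False by simp
  ultimately have "cos (pi / real (m i j)) > 0" by (intro cos_gt_zero) auto
  then show ?thesis by (simp add: weight_def False)
qed (simp add: weight_def)

lemma weight_nonpos: "i \<in> I \<Longrightarrow> j \<in> I \<Longrightarrow> i \<noteq> j \<Longrightarrow> weight i j \<le> 0"
  using weight_neg[of i j] weight_m_2[of i j] by fastforce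

lemma sum_simple_root: "i \<in> I \<Longrightarrow> (\<Sum>k\<in>I. simple_root i k * f k) = f i"
  using finite_I by (simp add: simple_root_def if_distrib[of "\<lambda>x. x * _"] sum.delta cong: if_cong)

lemma cox_form_simple_root:
  assumes "i \<in> I"
  shows "cox_form W I s v (simple_root i) = pairing v i"
proof -
  have "(\<Sum>j\<in>I. v k * simple_root i j * weight k j) = v k * weight k i" for k
    using sum_simple_root[OF assms, of "\<lambda>j. v k * weight k j"] by (simp add: mult_ac)
  then show ?thesis unfolding cox_form_def pairing_def weight_def[symmetric] by simp
qed

lemma refl_apply: "i \<in> I \<Longrightarrow> refl i v = (\<lambda>j. v j - 2 * pairing v i * simple_root i j)"
  by (simp add: simple_refl_def cox_form_simple_root)

lemma pairing_linear: "pairing (\<lambda>l. a * v l + b * w l) k = a * pairing v k + b * pairing w k"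
  by (simp add: pairing_def sum.distrib sum_distrib_left algebra_simps)

lemma pairing_simple_root: "i \<in> I \<Longrightarrow> pairing (simple_root i) k = weight i k"
  by (simp add: pairing_def sum_simple_root)

lemma refl_linear:
  "i \<in> I \<Longrightarrow> refl i (\<lambda>l. a * v l + b * w l) = (\<lambda>l. a * refl i v l + b * refl i w l)"
  by (simp add: refl_apply pairing_linear algebra_simps)

lemma foldr_refl_linear:
  "xs \<in> lists I \<Longrightarrow>
    foldr refl xs (\<lambda>l. a * v l + b * w l) = (\<lambda>l. a * foldr refl xs v l + b * foldr refl xs w l)"
  by (induction xs) (auto simp: refl_linear)

lemma refl_refl [simp]:
  assumes "i \<in> I"
  shows "refl i (refl i v) = v"
proof -
  have "pairing (refl i v) i = - pairing v i"
    using pairing_linear[of 1 v "- 2 * pairing v i" "simple_root i" i] assms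
    by (simp add: refl_apply pairing_simple_root)
  then show ?thesis using assms by (simp add: refl_apply[of i "refl i v"]) (simp add: refl_apply)
qed

text \<open>Each reflection changes only the coordinate of its own letter. This is how coordinates
  later detect letters missing from a word.\<close>

lemma foldr_refl_coord: "xs \<in> lists I \<Longrightarrow> k \<notin> set xs \<Longrightarrow> foldr refl xs v k = v k"
  by (induction xs) (auto simp: refl_apply simple_root_def)

section \<open>Dihedral relations for the simple reflections\<close>

lemma dihedral_step:
  assumes ij: "i \<in> I" "j \<in> I"
    and v: "pairing v i = 0" "pairing v j = 0"
    and c: "weight i j = - c"
  shows "refl j (\<lambda>l. v l + a * simple_root i l + b * simple_root j l)
    = (\<lambda>l. v l + a * simple_root i l + (2 * c * a - b) * simple_root j l)"
proof -
  have p: "pairing (\<lambda>l. v l + a * simple_root i l + b * simple_root j l) j = b - c * a"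
    using pairing_linear[of 1 "\<lambda>l. v l + a * simple_root i l" b "simple_root j" j]
      pairing_linear[of 1 v a "simple_root i" j] ij v c
    by (simp add: pairing_simple_root)
  show ?thesis unfolding refl_apply[OF ij(2)] p by (simp add: fun_eq_iff algebra_simps)
qed

text \<open>The two coefficients are consecutive terms of \<open>F\<close>. Reflecting in j replaces
  F(2n-1) by F(2n+1), then reflecting in i replaces F(2n) by F(2n+2). The start at F(-1) is why
  \<open>F\<close> lives on the integers.\<close>

lemma dihedral_power:
  fixes F :: "int \<Rightarrow> real"
  assumes ij: "i \<in> I" "j \<in> I"
    and v: "pairing v i = 0" "pairing v j = 0"
    and c: "weight i j = - c"
    and rec: "\<And>x. 2 * c * F (x + 1) - F x = F (x + 2)"
  shows "foldr refl (concat (replicate n [i, j]))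
      (\<lambda>l. v l + F 0 * simple_root i l + F (- 1) * simple_root j l)
    = (\<lambda>l. v l + F (2 * int n) * simple_root i l + F (2 * int n - 1) * simple_root j l)"
proof (induction n)
  case (Suc n)
  let ?x = "2 * int n"
  have swap: "(\<lambda>l. v l + p * simple_root h l + q * simple_root k l)
    = (\<lambda>l. v l + q * simple_root k l + p * simple_root h l)" for p q h k
    by (simp add: algebra_simps)
  have "2 * c * F ?x - F (?x - 1) = F (?x + 1)" using rec[of "?x - 1"] by (simp add: add.commute)
  then have "refl j (\<lambda>l. v l + F ?x * simple_root i l + F (?x - 1) * simple_root j l)
      = (\<lambda>l. v l + F ?x * simple_root i l + F (?x + 1) * simple_root j l)"
    using dihedral_step[OF ij v c, of "F ?x" "F (?x - 1)"] by (simp only:)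
  also have "\<dots> = (\<lambda>l. v l + F (?x + 1) * simple_root j l + F ?x * simple_root i l)"
    by (rule swap)
  finally have "refl i (refl j (\<lambda>l. v l + F ?x * simple_root i l + F (?x - 1) * simple_root j l))
      = refl i (\<lambda>l. v l + F (?x + 1) * simple_root j l + F ?x * simple_root i l)"
    by (rule arg_cong)
  also have "\<dots> = (\<lambda>l. v l + F (?x + 1) * simple_root j l + F (?x + 2) * simple_root i l)"
    unfolding rec[of ?x, symmetric]
    by (rule dihedral_step) (use ij v c weight_sym in auto)
  also have "\<dots> = (\<lambda>l. v l + F (?x + 2) * simple_root i l + F (?x + 1) * simple_root j l)"
    by (rule swap)
  finally show ?case using Suc by (simp add: algebra_simps)
qed simp

text \<open>
  Here \<open>u\<close> is the component of \<open>v\<close> fixed by both reflections. The coordinates of the rest obey the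
  linear recursion with characteristic roots \<open>exp (\<plusminus> \<i> \<pi> / m)\<close>, so they have period \<open>2 m\<close>.
\<close>

lemma refl_relation:
  assumes ij: "i \<in> I" "j \<in> I"
  shows "foldr refl (concat (replicate (m i j) [i, j])) v = v"
proof (cases "i = j \<or> m i j = 0")
  \<comment> \<open>For i = j the word is \<open>[i, i]\<close>, a squared reflection; infinite
    order is encoded by 0, where the word is empty.\<close>
  case True
  then show ?thesis using ij by auto
next
  case False
  define t where "t = pi / real (m i j)"
  have "m i j \<ge> 2" using False m_neq_1[of i j] ij by linarith
  then have "sin t > 0" unfolding t_def by (intro sin_gt_zero) (auto simp: field_simps)
  then have t: "sin t \<noteq> 0" by simp
  have c: "weight i j = - cos t" using False by (simp add: weight_def t_def)
  \<comment> \<open>The coefficients solve B(u, alpha_i) = B(u, alpha_j) = 0. The Gram matrix of the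
    two simple roots has determinant 1 - cos^2 t = sin^2 t, which is nonzero.\<close>
  define a where "a = (pairing v i + cos t * pairing v j) / (sin t)\<^sup>2"
  define b where "b = (pairing v j + cos t * pairing v i) / (sin t)\<^sup>2"
  define u where "u = (\<lambda>l. v l - a * simple_root i l - b * simple_root j l)"
  have pu: "pairing u k = pairing v k - a * weight i k - b * weight j k" for k
    using pairing_linear[of 1 "\<lambda>l. v l - a * simple_root i l" "-b" "simple_root j" k]
      pairing_linear[of 1 v "-a" "simple_root i" k] ij
    by (simp add: u_def pairing_simple_root)
  have ab: "(sin t)\<^sup>2 * a = pairing v i + cos t * pairing v j"
    "(sin t)\<^sup>2 * b = pairing v j + cos t * pairing v i"
    using t by (simp_all add: a_def b_def)
  have c2: "cos t * (cos t * x) = x - (sin t)\<^sup>2 * x" for x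
    using cos_squared_eq[of t] by (simp add: power2_eq_square left_diff_distrib flip: mult.assoc)
  have "(sin t)\<^sup>2 * (a - b * cos t) = (sin t)\<^sup>2 * pairing v i"
    by (simp only: right_diff_distrib mult.commute[of b] mult.left_commute[of _ "cos t"] ab)
      (simp add: distrib_left c2)
  then have "pairing u i = 0" using ij t c by (simp add: pu weight_sym[of j i])
  moreover have "(sin t)\<^sup>2 * (b - a * cos t) = (sin t)\<^sup>2 * pairing v j"
    by (simp only: right_diff_distrib mult.commute[of a] mult.left_commute[of _ "cos t"] ab)
      (simp add: distrib_left c2)
  then have "pairing u j = 0" using ij t c by (simp add: pu)
  \<comment> \<open>The solution of the recursion with F(0) = a and F(-1) = b, the initial
    coefficients in \<open>dihedral_power\<close>.\<close>
  moreover define F where "F x = (a * sin ((x + 1) * t) - b * sin (x * t)) / sin t" for x :: int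
  have "2 * cos t * F (x + 1) - F x = F (x + 2)" for x
  proof -
    have *: "sin (y + 2 * t) = 2 * cos t * sin (y + t) - sin y" for y
      using sin_add[of "y + t" t] sin_diff[of "y + t" t] by (simp add: algebra_simps)
    have "sin ((x + 2) * t) = 2 * cos t * sin ((x + 1) * t) - sin (x * t)"
      "sin ((x + 2 + 1) * t) = 2 * cos t * sin ((x + 1 + 1) * t) - sin ((x + 1) * t)"
      using *[of "x * t"] *[of "x * t + t"] by (simp_all add: algebra_simps)
    moreover have "2 * c * ((a * p - b * q) / z) - (a * p' - b * q') / z
      = (a * (2 * c * p - p') - b * (2 * c * q - q')) / z" if "z \<noteq> 0" for c p q p' q' z :: real
      using that by (simp add: field_simps)
    ultimately show ?thesis using t unfolding F_def by (simp only: of_int_add of_int_1 of_int_numeral)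
  qed
  ultimately have "foldr refl (concat (replicate (m i j) [i, j]))
      (\<lambda>l. u l + F 0 * simple_root i l + F (- 1) * simple_root j l)
    = (\<lambda>l. u l + F (2 * int (m i j)) * simple_root i l
        + F (2 * int (m i j) - 1) * simple_root j l)"
    by (intro dihedral_power[OF ij _ _ c]) auto
  moreover have "F 0 = a" "F (- 1) = b" using t by (simp_all add: F_def)
  moreover have "F (2 * int (m i j)) = a" "F (2 * int (m i j) - 1) = b"
  proof -
    have "2 * real (m i j) * t = 2 * pi" using False by (simp add: t_def)
    then have *: "2 * real (m i j) * t = 2 * pi" "(2 * real (m i j) + 1) * t = t + 2 * pi"
      "(2 * real (m i j) - 1) * t = - t + 2 * pi"
      by (auto simp: algebra_simps)
    then show "F (2 * int (m i j)) = a" "F (2 * int (m i j) - 1) = b"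
      using t by (simp_all add: F_def * del: mult_2)
  qed
  ultimately have "foldr refl (concat (replicate (m i j) [i, j]))
      (\<lambda>l. u l + a * simple_root i l + b * simple_root j l)
    = (\<lambda>l. u l + a * simple_root i l + b * simple_root j l)"
    by simp
  then show ?thesis by (simp add: u_def)
qed

text \<open>The presentation of W enters here: words with the same value are linked by insertions
  and deletions of relators, each of which acts trivially by \<open>refl_relation\<close>.\<close>

lemma foldr_refl_cong:
  assumes "xs \<in> lists I" "ys \<in> lists I" "wp xs = wp ys"
  shows "foldr refl xs v = foldr refl ys v"
proof -
  have step: "foldr refl xs v = foldr refl ys v" if "cox_step W I s xs ys" for xs ys
    using that by cases (simp add: refl_relation)
  from presentation[OF assms] show ?thesis
    by (induction rule: equivclp_induct) (auto dest: step)
qed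

text \<open>Frees \<open>cox_act\<close> from its chosen word, so that any convenient word may be
  used.\<close>

lemma act_wp:
  assumes "xs \<in> lists I"
  shows "act (wp xs) v = foldr refl xs v"
proof -
  let ?ys = "SOME ys. ys \<in> lists I \<and> wp ys = wp xs"
  have "?ys \<in> lists I \<and> wp ?ys = wp xs" by (rule someI) (use assms in auto)
  then show ?thesis unfolding cox_act_def using assms by (intro foldr_refl_cong) auto
qed

lemma act_mult:
  assumes "w \<in> carrier W" "w' \<in> carrier W"
  shows "act (w \<otimes> w') v = act w (act w' v)"
proof -
  obtain xs ys where "xs \<in> lists I" "ys \<in> lists I" "w = wp xs" "w' = wp ys"
    using assms carrier_eq_words by auto
  then show ?thesis by (simp add: act_wp flip: wp_append)
qed

lemma act_one [simp]: "act \<one> v = v"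
  using act_wp[of "[]"] by simp

lemma act_s: "i \<in> I \<Longrightarrow> act (s i) v = refl i v"
  using act_wp[of "[i]"] by (simp add: s_closed)

lemma act_linear:
  assumes "w \<in> carrier W"
  shows "act w (\<lambda>l. a * v l + b * v' l) = (\<lambda>l. a * act w v l + b * act w v' l)"
proof -
  obtain xs where "xs \<in> lists I" "w = wp xs" using assms carrier_eq_words by auto
  then show ?thesis by (simp add: act_wp foldr_refl_linear)
qed

lemma refl_simple_root: "i \<in> I \<Longrightarrow> refl i (simple_root i) = (\<lambda>l. - simple_root i l)"
  by (auto simp: refl_apply pairing_simple_root)

section \<open>Positivity\<close>

definition len :: "'a \<Rightarrow> nat" where
  "len w = (LEAST n. \<exists>xs\<in>lists I. length xs = n \<and> wp xs = w)"

lemma len_le: "xs \<in> lists I \<Longrightarrow> len (wp xs) \<le> length xs"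
  unfolding len_def by (rule Least_le) blast

lemma ex_reduced_word:
  assumes "w \<in> carrier W"
  obtains xs where "xs \<in> lists I" "wp xs = w" "length xs = len w"
proof -
  have "\<exists>n. \<exists>xs\<in>lists I. length xs = n \<and> wp xs = w"
    using assms carrier_eq_words by auto
  from LeastI_ex[OF this] show ?thesis using that unfolding len_def by blast
qed

lemma len_mult_wp:
  assumes "w \<in> carrier W" "ys \<in> lists I"
  shows "len (w \<otimes> wp ys) \<le> len w + length ys"
proof -
  obtain xs where "xs \<in> lists I" "wp xs = w" "length xs = len w" by (rule ex_reduced_word[OF assms(1)])
  then show ?thesis using len_le[of "xs @ ys"] assms(2) by (simp add: wp_append)
qed

lemma len_mult_s: "w \<in> carrier W \<Longrightarrow> i \<in> I \<Longrightarrow> len (w \<otimes> s i) \<le> Suc (len w)"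
  using len_mult_wp[of w "[i]"] by (simp add: s_closed)

text \<open>The alternating word of length \<open>n\<close> ending in \<open>j\<close>.\<close>

primrec alt :: "'i \<Rightarrow> 'i \<Rightarrow> nat \<Rightarrow> 'i list" where
  "alt i j 0 = []"
| "alt i j (Suc n) = (if even n then j else i) # alt i j n"

lemma alt_lists [simp]: "i \<in> I \<Longrightarrow> j \<in> I \<Longrightarrow> alt i j n \<in> lists I"
  by (induction n) auto

lemma length_alt [simp]: "length (alt i j n) = n"
  by (induction n) auto

lemma alt_snoc: "alt i j (Suc n) = alt j i n @ [j]"
  by (induction n) auto

text \<open>Alternating words are anchored at their last letter, so the parity of k decides which
  letter the left block ends in.\<close>

lemma alt_add: "alt i j (n + k) = (if even k then alt i j n else alt j i n) @ alt i j k"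
  by (induction n) auto

text \<open>\<open>alt_snoc\<close> exchanges the roles of i and j, and s_j conjugates s_i s_j to
  its inverse. At n = m(i,j) the power is trivial, which gives the braid relation.\<close>

lemma wp_alt_pow:
  assumes ij: "i \<in> I" "j \<in> I"
  shows "wp (alt i j n) = wp (alt j i n) \<otimes> (s i \<otimes> s j) [^] n"
proof (induction n)
  case (Suc n)
  let ?A = "wp (alt i j n)" and ?B = "wp (alt j i n)"
  have cl: "s i \<in> carrier W" "s j \<in> carrier W" "?A \<in> carrier W" "?B \<in> carrier W"
    using ij by (auto simp: s_closed)
  have conj: "s j \<otimes> (s i \<otimes> s j) [^] n = (s j \<otimes> s i) [^] n \<otimes> s j"
    by (induction n) (use cl in \<open>simp_all add: m_assoc\<close>, simp add: m_assoc[symmetric])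
  have inv: "(s i \<otimes> s j) [^] n \<otimes> (s j \<otimes> s i) [^] n = \<one>"
    using cl ij nat_pow_inv[of "s i \<otimes> s j" n] by (simp add: inv_s_s)
  have "wp (alt j i (Suc n)) \<otimes> (s i \<otimes> s j) [^] Suc n
      = ?A \<otimes> s i \<otimes> ((s i \<otimes> s j) \<otimes> (s i \<otimes> s j) [^] n)"
    using ij cl by (simp only: alt_snoc nat_pow_Suc2 m_closed) (simp add: wp_append)
  also have "\<dots> = ?A \<otimes> (s j \<otimes> (s i \<otimes> s j) [^] n)"
    using ij cl by (simp add: m_assoc)
  also have "\<dots> = ?B \<otimes> ((s i \<otimes> s j) [^] n \<otimes> (s j \<otimes> s i) [^] n) \<otimes> s j"
    unfolding conj Suc using cl by (simp add: m_assoc)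
  also have "\<dots> = ?B \<otimes> s j" using cl by (simp add: inv)
  also have "\<dots> = wp (alt i j (Suc n))"
    using ij cl by (simp only: alt_snoc) (simp add: wp_append)
  finally show ?case by simp
qed simp

lemma wp_alt_m: "i \<in> I \<Longrightarrow> j \<in> I \<Longrightarrow> wp (alt i j (m i j)) = wp (alt j i (m i j))"
  by (simp add: wp_alt_pow[of i j] cox_m_def s_closed)

text \<open>\<open>S\<close> is a rescaled Chebyshev sequence. Each reflection replaces the older of
  the two coefficients by the next term, so the parity of n decides which root carries the newer
  one.\<close>

lemma foldr_refl_alt:
  assumes ij: "i \<in> I" "j \<in> I"
    and S: "S 0 = 0" "S (Suc 0) = 1" "\<And>n. S (Suc (Suc n)) = - 2 * weight i j * S (Suc n) - S n"
  shows "foldr refl (alt i j n) (simple_root i) =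
    (if even n then (\<lambda>l. S (Suc n) * simple_root i l + S n * simple_root j l)
     else (\<lambda>l. S (Suc n) * simple_root j l + S n * simple_root i l))"
proof (induction n)
  case 0
  then show ?case by (simp add: S)
next
  case (Suc n)
  have z: "pairing (\<lambda>l. 0) k = 0" for k by (simp add: pairing_def)
  show ?case
    using Suc dihedral_step[of i j "\<lambda>l. 0" "- weight i j" "S (Suc n)" "S n"]
      dihedral_step[of j i "\<lambda>l. 0" "- weight i j" "S (Suc n)" "S n"] ij
    by (simp add: z S(3) weight_sym[of j i] algebra_simps)
qed

text \<open>The coefficients are S(n) and S(n+1). For finite order, S(k) = sin(kt) / sin t with t =
  pi / m(i,j), which is nonnegative for k \<le> m(i,j); for infinite order, S(k) = k.\<close>

lemma foldr_refl_alt_nonneg: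
  assumes ij: "i \<in> I" "j \<in> I" "i \<noteq> j" and n: "m i j = 0 \<or> n < m i j"
  obtains a b where "a \<ge> 0" "b \<ge> 0"
    "foldr refl (alt i j n) (simple_root i) = (\<lambda>l. a * simple_root i l + b * simple_root j l)"
proof -
  obtain S where S: "S 0 = 0" "S (Suc 0) = 1"
      "\<And>n. S (Suc (Suc n)) = - 2 * weight i j * S (Suc n) - S n"
    and pos: "S n \<ge> 0" "S (Suc n) \<ge> 0"
  proof (cases "m i j = 0")
    case True
    show ?thesis by (rule that[of real]) (auto simp: weight_def True)
  next
    case False
    define t where "t = pi / real (m i j)"
    have "m i j \<ge> 2" using False m_neq_1[of i j] ij by linarith
    then have t: "sin t > 0" unfolding t_def by (intro sin_gt_zero) (auto simp: field_simps)
    have sin_nonneg: "sin (real k * t) \<ge> 0" if "k \<le> m i j" for k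
      using that False by (intro sin_ge_zero) (auto simp: t_def field_simps)
    have c: "weight i j = - cos t" using False by (simp add: weight_def t_def)
    have *: "sin (y + 2 * t) = 2 * cos t * sin (y + t) - sin y" for y
      using sin_add[of "y + t" t] sin_diff[of "y + t" t] by (simp add: algebra_simps)
    show ?thesis
    proof (rule that[of "\<lambda>k. sin (real k * t) / sin t"])
      fix k
      show "sin (real (Suc (Suc k)) * t) / sin t
        = - 2 * weight i j * (sin (real (Suc k) * t) / sin t) - sin (real k * t) / sin t"
        using *[of "k * t"] t c by (simp add: field_simps)
    qed (use t sin_nonneg[of n] sin_nonneg[of "Suc n"] n False in auto)
  qed
  show ?thesis
    using foldr_refl_alt[OF ij(1,2) S, of n] pos that
    by (cases "even n") (auto simp: algebra_simps)
qed

text \<open>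
  Tits' argument: split off from a reduced word of \<open>w\<close> the longest possible alternating suffix in
  the letters \<open>i\<close>, \<open>j\<close>. By maximality the remaining factor \<open>v\<close> is not shortened by either of the two
  generators, so the induction hypothesis applies to both of them.
\<close>

theorem act_simple_root_nonneg:
  assumes "w \<in> carrier W" "i \<in> I" "len w \<le> len (w \<otimes> s i)"
  shows "act w (simple_root i) k \<ge> 0"
  using assms
proof (induction "len w" arbitrary: w i k rule: less_induct)
  case less
  obtain xs where xs: "xs \<in> lists I" "wp xs = w" "length xs = len w"
    by (rule ex_reduced_word[OF less.prems(1)])
  show ?case
  proof (cases xs rule: rev_cases)
    case Nil
    then show ?thesis using xs by (auto simp: simple_root_def)
  next
    case (snoc ys j)
    then have ys: "ys \<in> lists I" "j \<in> I" "w = wp ys \<otimes> s j" "len w = Suc (length ys)"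
      using xs by (auto simp: wp_append s_closed)
    have "i \<noteq> j"
    proof
      assume "i = j"
      then have "w \<otimes> s i = wp ys" using ys by simp
      then show False using less.prems len_le[OF ys(1)] ys by simp
    qed
    \<comment> \<open>Lengths are required to add up, so that the suffix belongs to a reduced word.
      This also bounds n by the length of w, and a maximal n exists.\<close>
    define P where "P n \<longleftrightarrow> (\<exists>v\<in>carrier W. w = v \<otimes> wp (alt i j n) \<and> len w = len v + n)" for n
    have "len w \<le> len (wp ys) + 1" using len_mult_s[of "wp ys" j] ys by simp
    then have "P 1"
      unfolding P_def using ys len_le[OF ys(1)] by (intro bexI[of _ "wp ys"]) (auto simp: s_closed)
    moreover have "\<forall>n. P n \<longrightarrow> n \<le> len w" by (auto simp: P_def)
    ultimately obtain n where n: "P n" and max: "\<And>n'. P n' \<Longrightarrow> n' \<le> n" and "n \<ge> 1"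
      by (metis GreatestI_nat Greatest_le_nat)
    then obtain v n' where v: "v \<in> carrier W" "w = v \<otimes> wp (alt i j n)" "len w = len v + n"
      and n': "n = Suc n'"
      unfolding P_def by (cases n) auto
    have nonneg: "act v (simple_root h) l \<ge> 0" if h: "h \<in> {i, j}" for h l
    proof (rule less.hyps)
      show "len v < len w" using v \<open>n \<ge> 1\<close> by simp
      show "h \<in> I" using h ys less.prems by auto
      show "len v \<le> len (v \<otimes> s h)"
      proof (rule ccontr)
        assume less': "\<not> ?thesis"
        let ?v = "v \<otimes> s h"
        have cl: "?v \<in> carrier W" "s h \<in> carrier W" using v \<open>h \<in> I\<close> by (auto simp: s_closed)
        have v_eq: "v = ?v \<otimes> s h" using v \<open>h \<in> I\<close> by simp
        have altI: "alt i j k \<in> lists I" for k using ys less.prems by simp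
        \<comment> \<open>Either h is the letter that would extend the alternating suffix to the
          left, contradicting maximality, or h is its first letter; then moving h into v would write
          w with fewer letters than its length.\<close>
        consider "h = (if even n then j else i)" | "h = (if even n' then j else i)"
          using h n' by (cases "even n'") auto
        then show False
        proof cases
          case 1
          then have "w = ?v \<otimes> wp (alt i j (Suc n))"
            using v(2) v_eq cl altI[of n] by (simp flip: m_assoc)
          moreover have "len w \<le> len ?v + Suc n"
            using len_mult_wp[OF cl(1) altI[of "Suc n"]] calculation by simp
          ultimately have "P (Suc n)"
            unfolding P_def using cl less' v by (intro bexI[of _ ?v]) auto
          then show False using max by fastforce
        next
          case 2
          then have "w = ?v \<otimes> wp (alt i j n')"
            using v(1,2) cl altI[of n'] n' by (simp add: m_assoc)
          then have "len w \<le> len ?v + n'"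
            using len_mult_wp[OF cl(1) altI[of n']] by simp
          then show False using less' v n' by simp
        qed
      qed
    qed (use v in auto)
    \<comment> \<open>A suffix of length at least m(i,j) could be rewritten by the braid relation to
      end in i. Then s_i would shorten w, against the hypothesis.\<close>
    have "m i j = 0 \<or> n < m i j"
    proof (rule ccontr)
      assume "\<not> ?thesis"
      then obtain k where k: "n = k + m i j" "m i j > 0" by (auto simp: le_iff_add not_less add.commute)
      define d where "d = (if even (m i j) then alt i j k else alt j i k)"
      have d: "d \<in> lists I" "length d = k" using ys less.prems by (auto simp: d_def)
      obtain q where q: "m i j = Suc q" using k by (cases "m i j") auto
      have alts: "alt i j q \<in> lists I" "alt j i q \<in> lists I" using ys less.prems by auto
      have "wp (alt i j n) = wp d \<otimes> wp (alt i j (m i j))"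
        using d ys less.prems unfolding k(1) alt_add by (simp add: wp_append d_def)
      also have "\<dots> = wp d \<otimes> wp (alt j i (m i j))"
        using wp_alt_m[OF less.prems(2) ys(2)] by simp
      also have "\<dots> = wp (d @ alt i j q) \<otimes> s i"
        using d alts less.prems
        by (simp only: q alt_snoc) (simp add: wp_append s_closed m_assoc)
      finally have "w = v \<otimes> wp (d @ alt i j q) \<otimes> s i"
        using v d alts less.prems by (simp add: m_assoc s_closed wp_append)
      then have "w \<otimes> s i = v \<otimes> wp (d @ alt i j q)"
        using v d alts less.prems by (simp add: wp_append)
      then have "len (w \<otimes> s i) \<le> len v + (k + q)"
        using len_mult_wp[OF v(1), of "d @ alt i j q"] d alts by simp
      then show False using less.prems v k q by simp
    qed
    then obtain a b where ab: "a \<ge> 0" "b \<ge> 0"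
      "foldr refl (alt i j n) (simple_root i) = (\<lambda>l. a * simple_root i l + b * simple_root j l)"
      using foldr_refl_alt_nonneg[of i j n] \<open>i \<noteq> j\<close> ys less.prems by metis
    have "act w (simple_root i) = act v (foldr refl (alt i j n) (simple_root i))"
      using v ys less.prems by (simp add: act_mult act_wp)
    also have "\<dots> = (\<lambda>l. a * act v (simple_root i) l + b * act v (simple_root j) l)"
      using v by (simp add: ab act_linear)
    finally show ?thesis using ab nonneg by simp
  qed
qed

section \<open>Words without repeated letters\<close>

text \<open>The term of k vanishes, and all other terms are nonpositive because distinct simple
  roots pair nonpositively. Only the term of i is kept.\<close>

lemma pairing_le:
  assumes "\<And>l. v l \<ge> 0" "v k = 0" "i \<in> I" "k \<in> I"
  shows "pairing v k \<le> v i * weight i k"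
proof -
  have "pairing v k = v i * weight i k + (\<Sum>l\<in>I - {i}. v l * weight l k)"
    unfolding pairing_def using finite_I assms by (simp add: sum.remove)
  moreover have "(\<Sum>l\<in>I - {i}. v l * weight l k) \<le> 0"
  proof (rule sum_nonpos)
    fix l assume "l \<in> I - {i}"
    then show "v l * weight l k \<le> 0"
      using assms weight_nonpos[of l k] by (cases "l = k") (auto simp: mult_nonneg_nonpos)
  qed
  ultimately show ?thesis by simp
qed

text \<open>When a letter k is reached, its coordinate is still 0 and becomes -2 B(v, alpha_k) for
  the current vector v. As v is nonnegative with i-coordinate 1, \<open>pairing_le\<close> gives
  B(v, alpha_k) \<le> B(alpha_i, alpha_k) \<le> 0.\<close>

lemma foldr_refl_distinct_coords:
  assumes "distinct q" "i \<notin> set q" "q \<in> lists I" "i \<in> I"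
  shows "(\<forall>k. foldr refl q (simple_root i) k \<ge> 0) \<and>
    (\<forall>k\<in>set q. foldr refl q (simple_root i) k \<ge> - 2 * weight i k)"
  using assms
proof (induction q)
  case Nil
  then show ?case by (simp add: simple_root_def)
next
  case (Cons k q)
  define v where "v = foldr refl q (simple_root i)"
  have IH: "\<And>l. v l \<ge> 0" "\<And>l. l \<in> set q \<Longrightarrow> v l \<ge> - 2 * weight i l"
    using Cons by (auto simp: v_def)
  have "v k = 0" "v i = 1"
    using Cons.prems foldr_refl_coord[of q] by (auto simp: v_def simple_root_def)
  then have p: "pairing v k \<le> weight i k"
    using pairing_le[of v k i] IH Cons.prems by simp
  have w: "weight i k \<le> 0" using Cons.prems by (intro weight_nonpos) auto
  have rv: "foldr refl (k # q) (simple_root i) l = (if l = k then - 2 * pairing v k else v l)" for l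
    using Cons.prems \<open>v k = 0\<close> by (simp add: refl_apply simple_root_other flip: v_def)
  show ?case unfolding rv using IH p w Cons.prems by auto
qed

text \<open>
  The \<open>i\<close>-coordinate of \<open>c \<alpha>\<^sub>i\<close> is \<open>-1\<close> exactly if \<open>i\<close> commutes with all letters after it
  in a word for \<open>c\<close> without repetitions, which is thus a property of \<open>c\<close> and not of the word.
\<close>

lemma commutes_with_later_letters:
  assumes xs: "xs @ [i] \<in> lists I" "distinct (xs @ [i])"
    and ys: "p @ i # q \<in> lists I" "distinct (p @ i # q)"
    and eq: "wp (xs @ [i]) = wp (p @ i # q)"
    and k: "k \<in> set q"
  shows "m i k = 2"
proof (rule ccontr)
  assume m: "m i k \<noteq> 2"
  have iI: "i \<in> I" "k \<in> I" "q \<in> lists I" "p \<in> lists I" "xs \<in> lists I" using ys xs k by auto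
  define v where "v = foldr refl q (simple_root i)"
  have v: "\<And>l. v l \<ge> 0" "v k \<ge> - 2 * weight i k" "v i = 1"
    using foldr_refl_distinct_coords[of q i] foldr_refl_coord[of q i] ys k iI
    by (auto simp: v_def simple_root_def)
  have w: "weight i k < 0" using m iI ys k by (intro weight_neg) auto
  have "foldr refl (xs @ [i]) (simple_root i) i = - 1"
    using foldr_refl_coord[of xs i] iI xs by (simp add: refl_simple_root)
  moreover have "foldr refl (p @ i # q) (simple_root i) i = 1 - 2 * pairing v i"
    using foldr_refl_coord[of p i] iI ys v by (simp add: refl_apply flip: v_def)
  ultimately have "pairing v i = 1"
    using foldr_refl_cong[OF xs(1) ys(1) eq, of "simple_root i"] by simp
  moreover have "pairing v i = 1 + (\<Sum>l\<in>I - {i}. v l * weight l i)"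
    unfolding pairing_def using finite_I iI v by (simp add: sum.remove)
  \<comment> \<open>A vanishing sum of nonpositive terms has only zero terms, but the term of k is
    negative: \<open>v k\<close> is positive and \<open>weight k i\<close> negative.\<close>
  ultimately have "(\<Sum>l\<in>I - {i}. v l * weight l i) = 0" by simp
  moreover have "v l * weight l i \<le> 0" if "l \<in> I - {i}" for l
    using v weight_nonpos[of l i] that iI by (auto simp: mult_nonneg_nonpos)
  ultimately have "v k * weight k i = 0"
    using sum_nonneg_eq_0_iff[of "I - {i}" "\<lambda>l. - (v l * weight l i)"] finite_I iI ys k
    by (auto simp: sum_negf)
  then show False using v w weight_sym iI by auto
qed

text \<open>The last letter of \<open>xs\<close> commutes with every letter after it in
  \<open>ys\<close>, so it can be moved to the end of \<open>ys\<close> and cancelled. The words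
  need only share their letters, hence expressions of Coxeter elements of W_J are covered
  too.\<close>

theorem foldr_eq_if_wp_eq:
  assumes closed: "\<And>i u. i \<in> I \<Longrightarrow> u \<in> X \<Longrightarrow> f i u \<in> X"
    and comm: "\<And>i j u. i \<in> I \<Longrightarrow> j \<in> I \<Longrightarrow> m i j = 2 \<Longrightarrow> u \<in> X \<Longrightarrow> f i (f j u) = f j (f i u)"
  shows "xs \<in> lists I \<Longrightarrow> ys \<in> lists I \<Longrightarrow> distinct xs \<Longrightarrow> distinct ys \<Longrightarrow> set xs = set ys \<Longrightarrow>
    wp xs = wp ys \<Longrightarrow> u \<in> X \<Longrightarrow> foldr f xs u = foldr f ys u"
proof (induction xs arbitrary: ys u rule: rev_induct)
  case Nil
  then show ?case by simp
next
  case (snoc i xs)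
  have "i \<in> set ys" using snoc.prems by auto
  then obtain p q where ys: "ys = p @ i # q" by (meson split_list)
  have lists: "p \<in> lists I" "q \<in> lists I" "xs \<in> lists I" "i \<in> I" using snoc.prems ys by auto
  have m2: "m i k = 2" if "k \<in> set q" for k
    using commutes_with_later_letters[of xs i p q k] snoc.prems ys that by simp
  \<comment> \<open>The same commutation past \<open>q\<close> is carried out twice, for the
    operators \<open>f\<close> here and in the group in \<open>wp_past\<close>.\<close>
  have past: "foldr f q (f i u) = f i (foldr f q u)"
  proof -
    have foldr_closed: "foldr f r u \<in> X" if "r \<in> lists I" for r
      using that \<open>u \<in> X\<close> by (induction r) (auto simp: closed)
    have "r \<in> lists I \<Longrightarrow> \<forall>k\<in>set r. m i k = 2 \<Longrightarrow> foldr f r (f i u) = f i (foldr f r u)" for r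
      by (induction r) (use lists foldr_closed comm[of i] in auto)
    then show ?thesis using lists m2 by blast
  qed
  have wp_past: "wp q \<otimes> s i = s i \<otimes> wp q"
  proof -
    have "r \<in> lists I \<Longrightarrow> \<forall>k\<in>set r. m i k = 2 \<Longrightarrow> wp r \<otimes> s i = s i \<otimes> wp r" for r
    proof (induction r)
      case (Cons k r)
      then have cl: "k \<in> I" "s k \<in> carrier W" "s i \<in> carrier W" "wp r \<in> carrier W"
        using lists by (auto simp: s_closed)
      have "wp (k # r) \<otimes> s i = (s k \<otimes> s i) \<otimes> wp r"
        using Cons cl by (simp add: m_assoc)
      also have "s k \<otimes> s i = s i \<otimes> s k"
        using commute_if_m_2[of i k] Cons cl lists by simp
      finally show ?case using cl by (simp add: m_assoc)
    qed (use lists in \<open>simp add: s_closed\<close>)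
    then show ?thesis using lists m2 by blast
  qed
  have "wp xs \<otimes> s i = wp p \<otimes> (s i \<otimes> wp q)"
    using snoc.prems(6) lists by (simp add: ys wp_append s_closed)
  also have "\<dots> = wp (p @ q) \<otimes> s i"
    using lists by (simp add: wp_append s_closed m_assoc flip: wp_past)
  finally have "wp xs = wp (p @ q)"
    using lists by (simp add: s_closed)
  moreover have "set xs = set (p @ q)"
    using snoc.prems ys by auto
  ultimately have "foldr f xs (f i u) = foldr f (p @ q) (f i u)"
    using snoc.IH[of "p @ q" "f i u"] snoc.prems lists ys closed by simp
  then show ?case by (simp add: ys past)
qed

section \<open>Toggles, and independence of promotion from the expression\<close>

lemma toggle_closed: "i \<in> I \<Longrightarrow> u \<in> carrier W \<Longrightarrow> toggle W I s L i u \<in> carrier W"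
  by (simp add: toggle_def s_closed)

text \<open>If m(h,k) = 2, then s_k fixes alpha_h, so replacing u by s_k u leaves u^{-1} alpha_h
  unchanged. Neither toggle affects the decision made by the other.\<close>

lemma toggle_commute:
  assumes ij: "i \<in> I" "j \<in> I" and m2: "m i j = 2" and u: "u \<in> carrier W"
  shows "toggle W I s L i (toggle W I s L j u) = toggle W I s L j (toggle W I s L i u)"
proof -
  have "act (inv (s k \<otimes> u)) (simple_root h) = act (inv u) (simple_root h)"
    if "h \<in> I" "k \<in> I" "m h k = 2" for h k
    using that u weight_m_2[of h k]
    by (simp add: inv_mult_group s_closed act_mult act_s refl_apply pairing_simple_root)
  from this[of i j] this[of j i] show ?thesis
    using ij u m2 commute_if_m_2[OF ij m2]
    by (simp add: toggle_def m_sym[of j i] s_closed flip: m_assoc)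
qed

lemma promotion_eq:
  assumes "distinct xs" "set xs = I" "u \<in> carrier W"
  shows "promotion W I s L (wp xs) u = foldr (toggle W I s L) xs u"
proof -
  let ?ys = "SOME ys. ys \<in> cox_expressions W I s (wp xs)"
  have "xs \<in> cox_expressions W I s (wp xs)" using assms by (simp add: cox_expressions_def)
  then have "?ys \<in> cox_expressions W I s (wp xs)" by (rule someI)
  then show ?thesis
    unfolding promotion_def using assms
    by (intro foldr_eq_if_wp_eq[where X = "carrier W"] toggle_closed toggle_commute)
      (auto simp: cox_expressions_def)
qed

end

section \<open>Standard parabolic subgroups\<close>

locale parabolic = coxeter_system W I s
  for W :: "('a, 'm) monoid_scheme" (structure) and I :: "'i set" and s :: "'i \<Rightarrow> 'a" +
  fixes J :: "'i set"
  assumes J: "J \<subseteq> I"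
begin

abbreviation WJ :: "('a, 'm) monoid_scheme" where "WJ \<equiv> subgroup_generated W (s ` J)"

lemma lists_J: "xs \<in> lists J \<Longrightarrow> xs \<in> lists I"
  using J by auto

lemma carrier_WJ: "carrier WJ = wp ` lists J"
proof -
  have "carrier W \<inter> s ` J = s ` J" using J s_closed by auto
  then show ?thesis by (simp add: carrier_subgroup_generated generate_eq_words[OF J])
qed

lemma WJ_word:
  assumes "w \<in> carrier WJ"
  obtains xs where "xs \<in> lists J" "xs \<in> lists I" "w = wp xs"
  using assms carrier_WJ lists_J by blast

lemma WJ_closed: "w \<in> carrier WJ \<Longrightarrow> w \<in> carrier W"
  by (elim WJ_word) simp

lemma WJ_mult: "v \<in> carrier WJ \<Longrightarrow> w \<in> carrier WJ \<Longrightarrow> v \<otimes> w \<in> carrier WJ"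
  using subgroup.m_closed[OF subgroup_subgroup_generated] .

lemma WJ_inv: "w \<in> carrier WJ \<Longrightarrow> inv w \<in> carrier WJ"
  using subgroup.m_inv_closed[OF subgroup_subgroup_generated] .

lemma s_WJ: "j \<in> J \<Longrightarrow> s j \<in> carrier WJ"
  using J by (auto simp: carrier_WJ s_closed intro!: image_eqI[of _ _ "[j]"])

section \<open>Roots and half-spaces of W_J inside W\<close>

lemma word_prod_WJ: "word_prod WJ s = wp"
  by (simp add: word_prod_def fun_eq_iff)

lemma cox_m_WJ: "cox_m WJ s = m"
  unfolding cox_m_def group.ord_def[OF group_subgroup_generated] ord_def
  by (simp add: pow_subgroup_generated)

lemma cox_form_WJ:
  assumes "\<And>k. k \<notin> J \<Longrightarrow> v k = 0" "\<And>k. k \<notin> J \<Longrightarrow> w k = 0"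
  shows "cox_form WJ J s v w = cox_form W I s v w"
proof -
  have "(\<Sum>l\<in>J. v k * w l * weight k l) = (\<Sum>l\<in>I. v k * w l * weight k l)" for k
    using finite_I J assms by (intro sum.mono_neutral_left) auto
  moreover have "(\<Sum>k\<in>J. \<Sum>l\<in>I. v k * w l * weight k l) = (\<Sum>k\<in>I. \<Sum>l\<in>I. v k * w l * weight k l)"
    using finite_I J assms by (intro sum.mono_neutral_left) auto
  ultimately show ?thesis
    unfolding cox_form_def cox_m_WJ weight_def[symmetric] by simp
qed

lemma foldr_refl_WJ:
  assumes "xs \<in> lists J" and v: "\<And>k. k \<notin> J \<Longrightarrow> v k = 0"
  shows "foldr (simple_refl WJ J s) xs v = foldr refl xs v"
  using assms(1)
proof (induction xs)
  case (Cons i xs)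
  have "foldr refl xs v k = 0" if "k \<notin> J" for k
    using foldr_refl_coord[of xs k v] Cons that v lists_J by auto
  then have "cox_form WJ J s (foldr refl xs v) (simple_root i)
      = cox_form W I s (foldr refl xs v) (simple_root i)"
    using Cons by (intro cox_form_WJ) (auto simp: simple_root_def)
  then have "simple_refl WJ J s i (foldr refl xs v) = refl i (foldr refl xs v)"
    unfolding simple_refl_def by (simp only:)
  then show ?case using Cons by simp
qed simp

text \<open>The word over J chosen by \<open>cox_act\<close> is also a word over I, so independence
  of the choice is inherited from W.\<close>

lemma cox_act_WJ:
  assumes "w \<in> carrier WJ" and "\<And>k. k \<notin> J \<Longrightarrow> v k = 0"
  shows "cox_act WJ J s w v = act w v"
proof -
  let ?xs = "SOME xs. xs \<in> lists J \<and> wp xs = w"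
  have xs: "?xs \<in> lists J \<and> wp ?xs = w"
    by (rule someI_ex) (use assms carrier_WJ in auto)
  have "cox_act WJ J s w v = foldr refl ?xs v"
    unfolding cox_act_def word_prod_WJ using xs assms by (intro foldr_refl_WJ) auto
  also have "\<dots> = act w v" using xs act_wp[of ?xs v] lists_J by simp
  finally show ?thesis .
qed

lemma act_WJ_coord: "w \<in> carrier WJ \<Longrightarrow> k \<notin> J \<Longrightarrow> act w v k = v k"
  by (elim WJ_word) (auto simp: act_wp[simplified] intro!: foldr_refl_coord)

lemma simple_root_outside: "j \<in> J \<Longrightarrow> k \<notin> J \<Longrightarrow> simple_root j k = 0"
  by (auto simp: simple_root_def)

lemma roots_WJ: "roots WJ J s = {act w (simple_root j) | w j. w \<in> carrier WJ \<and> j \<in> J}"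
  unfolding roots_def using cox_act_WJ simple_root_outside by (metis (no_types, lifting))

lemma roots_WJ_subset: "roots WJ J s \<subseteq> roots W I s"
  unfolding roots_WJ unfolding roots_def using J WJ_closed by blast

lemma roots_WJ_coord: "\<beta> \<in> roots WJ J s \<Longrightarrow> k \<notin> J \<Longrightarrow> \<beta> k = 0"
  unfolding roots_WJ using act_WJ_coord simple_root_outside by auto

lemma act_roots_WJ: "w \<in> carrier WJ \<Longrightarrow> \<beta> \<in> roots WJ J s \<Longrightarrow> act w \<beta> \<in> roots WJ J s"
  unfolding roots_WJ using WJ_mult WJ_closed act_mult by (smt (verit) mem_Collect_eq)

text \<open>Roots of W_J vanish outside J, so nonnegativity on J and on I agree for them.\<close>

lemma half_space_WJ:
  assumes "\<beta> \<in> roots WJ J s"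
  shows "half_space WJ J s \<beta> = carrier WJ \<inter> half_space W I s \<beta>"
proof -
  have "cox_act WJ J s w \<beta> \<in> pos_roots WJ J s \<longleftrightarrow> act w \<beta> \<in> pos_roots W I s"
    if "w \<in> carrier WJ" for w
  proof -
    have "cox_act WJ J s w \<beta> = act w \<beta>" using that assms by (intro cox_act_WJ roots_WJ_coord)
    moreover have r: "act w \<beta> \<in> roots WJ J s" using that assms by (rule act_roots_WJ)
    moreover have "(\<forall>i\<in>J. 0 \<le> act w \<beta> i) \<longleftrightarrow> (\<forall>i\<in>I. 0 \<le> act w \<beta> i)"
      using roots_WJ_coord[OF r] J by (metis order_refl subsetD)
    ultimately show ?thesis using roots_WJ_subset by (auto simp: pos_roots_def)
  qed
  then show ?thesis using WJ_closed by (auto simp: half_space_def)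
qed

text \<open>If s_i shortened w, then positivity would apply to w s_i instead. But w s_i alpha_i = -
  w alpha_i has i-coordinate -1, as w in W_J leaves that coordinate alone.\<close>

lemma act_WJ_positive:
  assumes w: "w \<in> carrier WJ" and i: "i \<in> I - J"
  shows "act w (simple_root i) \<in> pos_roots W I s"
proof -
  have wW: "w \<in> carrier W" using w by (rule WJ_closed)
  have "act w (simple_root i) k \<ge> 0" for k
  proof (rule act_simple_root_nonneg[OF wW])
    show "len w \<le> len (w \<otimes> s i)"
    proof (rule ccontr)
      assume "\<not> ?thesis"
      then have "act (w \<otimes> s i) (simple_root i) i \<ge> 0"
        using wW i by (intro act_simple_root_nonneg) (auto simp: s_closed)
      moreover have "act (w \<otimes> s i) (simple_root i) i = - 1"
        using wW i w by (simp add: act_mult act_s s_closed refl_simple_root act_WJ_coord)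
      ultimately show False by simp
    qed
  qed (use i in auto)
  then show ?thesis using wW i by (auto simp: pos_roots_def roots_def)
qed

section \<open>Extending convex sets from W_J to W\<close>

text \<open>
  All of \<open>R(L')\<close> is used instead of some set of roots defining \<open>L'\<close>: otherwise the extension could
  leave the half-space of a root in \<open>R(L')\<close>, and the toggles of the parabolic subgroup would change.
\<close>

definition extension :: "'a set \<Rightarrow> 'a set" where
  "extension L' = carrier W \<inter> (\<Inter>\<beta>\<in>convex_roots WJ J s L' \<union>
    {act w (simple_root i) | w i. w \<in> carrier WJ \<and> i \<in> I - J}. half_space W I s \<beta>)"

lemma mem_extension:
  "y \<in> extension L' \<longleftrightarrow> y \<in> carrier W \<and> (\<forall>\<beta>\<in>convex_roots WJ J s L'. y \<in> half_space W I s \<beta>) \<and>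
    (\<forall>w\<in>carrier WJ. \<forall>i\<in>I - J. y \<in> half_space W I s (act w (simple_root i)))"
  unfolding extension_def by blast

lemma convex_extension: "cox_convex W I s (extension L')"
proof -
  let ?F = "convex_roots WJ J s L' \<union> {act w (simple_root i) | w i. w \<in> carrier WJ \<and> i \<in> I - J}"
  have "{act w (simple_root i) | w i. w \<in> carrier WJ \<and> i \<in> I - J} \<subseteq> roots W I s"
    unfolding roots_def using WJ_closed by blast
  then have "?F \<subseteq> roots W I s"
    using roots_WJ_subset unfolding convex_roots_def by blast
  then show ?thesis unfolding cox_convex_def extension_def by (rule exI[of _ ?F, OF conjI]) (rule HOL.refl)
qed

text \<open>For y in L' and w in W_J, the product y w stays in W_J, so y sends w alpha_i to a
  positive root by \<open>act_WJ_positive\<close>.\<close>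

lemma subset_extension:
  assumes "L' \<subseteq> carrier WJ"
  shows "L' \<subseteq> extension L'"
proof
  fix y assume y: "y \<in> L'"
  then have yJ: "y \<in> carrier WJ" using assms by auto
  have "y \<in> half_space W I s \<beta>" if "\<beta> \<in> convex_roots WJ J s L'" for \<beta>
    using that y half_space_WJ[of \<beta>] by (auto simp: convex_roots_def)
  moreover have "y \<in> half_space W I s (act w (simple_root i))" if "w \<in> carrier WJ" "i \<in> I - J" for w i
    using act_WJ_positive[of "y \<otimes> w" i] that yJ WJ_mult WJ_closed
    by (simp add: half_space_def act_mult)
  ultimately show "y \<in> extension L'" unfolding mem_extension using yJ WJ_closed by blast
qed

text \<open>Any family of roots defining L' lies in R(L'), so its half-spaces are among those
  cutting out the extension.\<close>

lemma extension_inter: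
  assumes "cox_convex WJ J s L'"
  shows "extension L' \<inter> carrier WJ \<subseteq> L'"
proof
  fix y assume y: "y \<in> extension L' \<inter> carrier WJ"
  obtain F where F: "F \<subseteq> roots WJ J s" and L': "L' = carrier WJ \<inter> (\<Inter>\<beta>\<in>F. half_space WJ J s \<beta>)"
    using assms unfolding cox_convex_def by (elim exE conjE) (rule that)
  have "y \<in> half_space WJ J s \<beta>" if "\<beta> \<in> F" for \<beta>
  proof -
    have "L' \<subseteq> half_space WJ J s \<beta>"
      unfolding L' using that by (intro le_infI2 INF_lower)
    then have "\<beta> \<in> convex_roots WJ J s L'"
      using that F by (auto simp: convex_roots_def)
    then have "y \<in> half_space W I s \<beta>" using y by (simp add: mem_extension)
    then show ?thesis using that F y half_space_WJ[of \<beta>] by blast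
  qed
  then show "y \<in> L'" unfolding L' using y by simp
qed

lemma convex_roots_extension:
  assumes "L' \<subseteq> carrier WJ" "\<beta> \<in> roots WJ J s"
  shows "\<beta> \<in> convex_roots W I s (extension L') \<longleftrightarrow> \<beta> \<in> convex_roots WJ J s L'"
proof
  assume "\<beta> \<in> convex_roots W I s (extension L')"
  then show "\<beta> \<in> convex_roots WJ J s L'"
    using assms subset_extension[OF assms(1)] half_space_WJ[of \<beta>] by (auto simp: convex_roots_def)
next
  assume "\<beta> \<in> convex_roots WJ J s L'"
  then have "extension L' \<subseteq> half_space W I s \<beta>" unfolding extension_def by (intro le_infI2 INF_lower) simp
  then show "\<beta> \<in> convex_roots W I s (extension L')"
    using assms roots_WJ_subset by (auto simp: convex_roots_def)
qed

section \<open>Toggles and promotion on W_J\<close>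

lemma toggle_extension_inside:
  assumes "L' \<subseteq> carrier WJ" "j \<in> J" "u \<in> carrier WJ"
  shows "toggle WJ J s L' j u = toggle W I s (extension L') j u"
proof -
  have "cox_act WJ J s (inv u) (simple_root j) = act (inv u) (simple_root j)"
    using assms WJ_inv simple_root_outside by (intro cox_act_WJ) auto
  moreover have "act (inv u) (simple_root j) \<in> roots WJ J s"
    unfolding roots_WJ using assms WJ_inv by blast
  ultimately show ?thesis using assms by (simp add: toggle_def convex_roots_extension)
qed

text \<open>The root u^{-1} alpha_i is one of those imposed on the extension, since u^{-1} lies in
  W_J.\<close>

lemma toggle_extension_outside:
  assumes "i \<in> I - J" "u \<in> carrier WJ"
  shows "toggle W I s (extension L') i u = u"
proof -
  have "extension L' \<subseteq> half_space W I s (act (inv u) (simple_root i))"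
    unfolding extension_def using assms WJ_inv[of u] by (intro le_infI2 INF_lower) blast
  moreover have "act (inv u) (simple_root i) \<in> roots W I s"
    unfolding roots_def using assms WJ_inv WJ_closed by blast
  ultimately show ?thesis by (simp add: toggle_def convex_roots_def)
qed

lemma foldr_toggle_extension:
  assumes L': "L' \<subseteq> carrier WJ" and xs: "xs \<in> lists I" and u: "u \<in> carrier WJ"
  shows "foldr (toggle W I s (extension L')) xs u \<in> carrier WJ"
    and "foldr (toggle W I s (extension L')) xs u = foldr (toggle WJ J s L') (filter (\<lambda>i. i \<in> J) xs) u"
proof -
  have cl: "toggle W I s (extension L') i v \<in> carrier WJ" if "i \<in> I" "v \<in> carrier WJ" for i v
    using that toggle_extension_outside[of i v L'] s_WJ WJ_mult
    by (cases "i \<in> J") (auto simp: toggle_def)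
  show *: "foldr (toggle W I s (extension L')) xs u \<in> carrier WJ"
    using xs u by (induction xs) (auto simp: cl)
  have "foldr (toggle W I s (extension L')) xs u \<in> carrier WJ \<and>
    foldr (toggle W I s (extension L')) xs u = foldr (toggle WJ J s L') (filter (\<lambda>i. i \<in> J) xs) u"
    using xs u
    by (induction xs) (auto simp: cl toggle_extension_inside[OF L'] toggle_extension_outside)
  then show "foldr (toggle W I s (extension L')) xs u = foldr (toggle WJ J s L') (filter (\<lambda>i. i \<in> J) xs) u"
    by blast
qed

text \<open>The expression chosen by \<open>promotion\<close> in W_J may differ from the filtered
  word. The two are compared through the toggles of W, for which \<open>foldr_eq_if_wp_eq\<close> is
  available.\<close>

lemma promotion_extension:
  assumes L': "L' \<subseteq> carrier WJ" and xs: "distinct xs" "set xs = I" and u: "u \<in> carrier WJ"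
  shows "promotion WJ J s L' (wp (filter (\<lambda>i. i \<in> J) xs)) u = promotion W I s (extension L') (wp xs) u"
proof -
  let ?zs = "filter (\<lambda>i. i \<in> J) xs"
  let ?ys = "SOME ys. ys \<in> cox_expressions WJ J s (wp ?zs)"
  have zs: "distinct ?zs" "set ?zs = J" using xs J by auto
  then have "?zs \<in> cox_expressions WJ J s (wp ?zs)"
    by (simp add: cox_expressions_def word_prod_WJ)
  then have "?ys \<in> cox_expressions WJ J s (wp ?zs)" by (rule someI)
  then have ys: "distinct ?ys" "set ?ys = J" "wp ?ys = wp ?zs"
    by (auto simp: cox_expressions_def word_prod_WJ)
  have lists: "?ys \<in> lists I" "?zs \<in> lists I" "xs \<in> lists I" using ys zs J xs by auto
  have filter_J: "filter (\<lambda>i. i \<in> J) ws = ws" if "set ws = J" for ws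
    using that by simp
  have "promotion WJ J s L' (wp ?zs) u = foldr (toggle WJ J s L') ?ys u"
    by (simp add: promotion_def)
  also have "\<dots> = foldr (toggle W I s (extension L')) ?ys u"
    using foldr_toggle_extension(2)[OF L' lists(1) u] filter_J[OF ys(2)] by simp
  also have "\<dots> = foldr (toggle W I s (extension L')) ?zs u"
    using lists ys zs u WJ_closed
    by (intro foldr_eq_if_wp_eq[where X = "carrier W"] toggle_closed toggle_commute) auto
  also have "\<dots> = foldr (toggle W I s (extension L')) xs u"
    using foldr_toggle_extension(2)[OF L' _ u] lists by simp
  also have "\<dots> = promotion W I s (extension L') (wp xs) u"
    using xs u WJ_closed by (simp add: promotion_eq)
  finally show ?thesis .
qed

section \<open>Transfer of futuristic Coxeter elements\<close>

theorem futuristic_element_WJ: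
  assumes xs: "distinct xs" "set xs = I" and fut: "futuristic_element W I s (wp xs)"
  shows "futuristic_element WJ J s (wp (filter (\<lambda>i. i \<in> J) xs))"
  unfolding futuristic_element_def heavy_def
proof (intro allI impI ballI; elim conjE exE)
  fix L' u K
  let ?P = "promotion WJ J s L' (wp (filter (\<lambda>i. i \<in> J) xs))"
  assume ne: "L' \<noteq> {}" and conv: "cox_convex WJ J s L'" and u: "u \<in> carrier WJ"
    and K: "K \<ge> 1" "(?P ^^ K) u = u"
  have L': "L' \<subseteq> carrier WJ" using conv unfolding cox_convex_def by blast
  \<comment> \<open>Membership in W_J is carried along, since the two promotions are known to agree
    only there.\<close>
  have "(promotion W I s (extension L') (wp xs) ^^ n) u = (?P ^^ n) u \<and> (?P ^^ n) u \<in> carrier WJ" for n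
  proof (induction n)
    case (Suc n)
    have "promotion W I s (extension L') (wp xs) ((?P ^^ n) u) \<in> carrier WJ"
      using Suc xs L' foldr_toggle_extension(1)[OF L', of xs] WJ_closed by (auto simp: promotion_eq)
    then show ?case using Suc promotion_extension[OF L' xs] by simp
  qed (simp add: u)
  then have "\<exists>K\<ge>1. (promotion W I s (extension L') (wp xs) ^^ K) u = u" using K by metis
  moreover have "extension L' \<noteq> {}" using subset_extension[OF L'] ne by auto
  ultimately have "u \<in> extension L'"
    using fut convex_extension u WJ_closed unfolding futuristic_element_def heavy_def by blast
  then show "u \<in> L'" using extension_inter[OF conv] u by blast
qed

text \<open>The letters outside J are appended in any order; deleting them recovers the given
  expression of c.\<close>

theorem futuristic_WJ:
  assumes "futuristic W I s"
  shows "futuristic WJ J s"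
  unfolding futuristic_def
proof
  fix c assume "c \<in> coxeter_elements WJ J s"
  then obtain ys where ys: "distinct ys" "set ys = J" "wp ys = c"
    by (auto simp: coxeter_elements_def cox_expressions_def word_prod_WJ)
  obtain zs where zs: "set zs = I - J" "distinct zs"
    using finite_distinct_list[of "I - J"] finite_I by auto
  have xs: "distinct (ys @ zs)" "set (ys @ zs) = I" using ys zs J by auto
  then have "wp (ys @ zs) \<in> coxeter_elements W I s"
    unfolding coxeter_elements_def cox_expressions_def by blast
  then have "futuristic_element W I s (wp (ys @ zs))"
    using assms by (simp add: futuristic_def)
  from futuristic_element_WJ[OF xs this] show "futuristic_element WJ J s c"
    using ys zs by (simp cong: filter_cong)
qed

theorem ancient_if_WJ_ancient:
  assumes "ancient WJ J s"
  shows "ancient W I s"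
  unfolding ancient_def
proof (intro ballI notI)
  fix c assume "c \<in> coxeter_elements W I s" and c: "futuristic_element W I s c"
  then obtain xs where xs: "distinct xs" "set xs = I" "wp xs = c"
    by (auto simp: coxeter_elements_def cox_expressions_def)
  then have "distinct (filter (\<lambda>i. i \<in> J) xs)" "set (filter (\<lambda>i. i \<in> J) xs) = J"
    using J by auto
  then have "wp (filter (\<lambda>i. i \<in> J) xs) \<in> coxeter_elements WJ J s"
    unfolding coxeter_elements_def cox_expressions_def word_prod_WJ by blast
  then show False
    using assms futuristic_element_WJ[of xs] xs c by (auto simp: ancient_def)
qed

end

theorem proposition1p12:
  fixes W :: "('a, 'm) monoid_scheme" and I J :: "'i set" and s :: "'i \<Rightarrow> 'a"
  assumes "coxeter_system W I s"
    and "J \<subseteq> I"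
  shows "(futuristic W I s \<longrightarrow> futuristic (subgroup_generated W (s ` J)) J s) \<and>
         (ancient (subgroup_generated W (s ` J)) J s \<longrightarrow> ancient W I s)"
proof -
  interpret parabolic W I s J
    using assms by (simp add: parabolic_def parabolic_axioms_def)
  show ?thesis using futuristic_WJ ancient_if_WJ_ancient by blast
qed

end
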